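(* Every completely regular Baire space with the $L$-property and the countable chain condition is a separable space.
   Context: A function $f:X\times Y\to\mathbb R$ on a product of topological spaces is separately continuous if it is continuous in each variable when the other is fixed. A function $f:Z\to\mathbb R$ on a topological space $Z$ is a first Lebesgue class function if $f^{-1}(G)$ is an $F_\sigma$-set in $Z$ (a countable union of closed sets) for every open set $G\subseteq\mathbb R$. A topological space $X$ has the $L$-property if for every topological space $Y$ each separately continuous function $f:X\times Y\to\mathbb R$ is a first Lebesgue class function on $X\times Y$ (with the product topology). A topological space $X$ has the countable chain condition if every system of pairwise disjoint open sets in $X$ is at most countable. A Baire space is a topological space in which every countable intersection of dense open sets is dense. *)

theory Defs
  imports "HOL-Analysis.Analysis"
begin

definition separately_continuous ::
    "'a topology \<Rightarrow> 'b topology \<Rightarrow> ('a \<times> 'b \<Rightarrow> real) \<Rightarrow> bool" where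
  "separately_continuous X Y f \<longleftrightarrow>
     (\<forall>y\<in>topspace Y. continuous_map X euclideanreal (\<lambda>x. f (x, y))) \<and>
     (\<forall>x\<in>topspace X. continuous_map Y euclideanreal (\<lambda>y. f (x, y)))"

definition first_Lebesgue_class :: "'a topology \<Rightarrow> ('a \<Rightarrow> real) \<Rightarrow> bool" where
  "first_Lebesgue_class Z f \<longleftrightarrow>
     (\<forall>G. open G \<longrightarrow> fsigma_in Z {z \<in> topspace Z. f z \<in> G})"

text \<open>
  HOL cannot quantify over all types inside a formula, so the space \<open>Y\<close> ranges over all
  topologies whose points are functions \<open>'a \<Rightarrow> real\<close>. This loses no generality: the lemma
  \<open>L_property_any_type\<close> below derives the property for spaces \<open>Y\<close> over an arbitrary type.
\<close>
definition L_property :: "'a topology \<Rightarrow> bool" where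
  "L_property X \<longleftrightarrow>
     (\<forall>(Y :: ('a \<Rightarrow> real) topology) f.
        separately_continuous X Y f \<longrightarrow> first_Lebesgue_class (prod_topology X Y) f)"

definition countable_chain_condition :: "'a topology \<Rightarrow> bool" where
  "countable_chain_condition X \<longleftrightarrow>
     (\<forall>\<U>. (\<forall>U\<in>\<U>. openin X U) \<and> pairwise disjnt \<U> \<longrightarrow> countable \<U>)"

text \<open>The intersection with \<open>topspace X\<close> gives the empty family its intended intersection.\<close>
definition Baire_space :: "'a topology \<Rightarrow> bool" where
  "Baire_space X \<longleftrightarrow>
     (\<forall>\<G>. countable \<G> \<and> (\<forall>G\<in>\<G>. openin X G \<and> X closure_of G = topspace X)
        \<longrightarrow> X closure_of (topspace X \<inter> \<Inter>\<G>) = topspace X)"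

lemma fsigma_in_continuous_map_preimage:
  assumes "continuous_map Z W h" and "fsigma_in W S"
  shows "fsigma_in Z {z \<in> topspace Z. h z \<in> S}"
proof -
  obtain T where T: "countable T" "T \<subseteq> Collect (closedin W)" "\<Union>T = S"
    using assms(2) by (auto simp: fsigma_in_def union_of_def)
  have "{z \<in> topspace Z. h z \<in> S} = \<Union>((\<lambda>C. {z \<in> topspace Z. h z \<in> C}) ` T)"
    using T(3) by auto
  moreover have "fsigma_in Z (\<Union>((\<lambda>C. {z \<in> topspace Z. h z \<in> C}) ` T))"
  proof (rule fsigma_in_Union)
    show "countable ((\<lambda>C. {z \<in> topspace Z. h z \<in> C}) ` T)"
      using T(1) by simp
    show "fsigma_in Z S'" if "S' \<in> (\<lambda>C. {z \<in> topspace Z. h z \<in> C}) ` T" for S'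
      using that T(2) assms(1)
      by (auto intro!: closed_imp_fsigma_in closedin_continuous_map_preimage)
  qed
  ultimately show ?thesis by simp
qed

lemma L_property_any_type:
  fixes X :: "'a topology" and Y :: "'b topology" and f :: "'a \<times> 'b \<Rightarrow> real"
  assumes L: "L_property X" and sep: "separately_continuous X Y f"
  shows "first_Lebesgue_class (prod_topology X Y) f"
proof -
  define P where "P = product_topology (\<lambda>_::'a. euclideanreal) (topspace X)"
  define Y' where "Y' = subtopology P {g. continuous_map X euclideanreal g}"
  define e :: "'a \<times> ('a \<Rightarrow> real) \<Rightarrow> real" where "e = (\<lambda>(x, g). g x)"
  define p where "p y = restrict (\<lambda>x. f (x, y)) (topspace X)" for y
  have "continuous_map P euclideanreal (\<lambda>g. g x)" if "x \<in> topspace X" for x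
    using that unfolding P_def by (rule continuous_map_product_projection)
  then have "separately_continuous X Y' e"
    unfolding separately_continuous_def Y'_def e_def
    by (auto intro: continuous_map_from_subtopology)
  then have e: "first_Lebesgue_class (prod_topology X Y') e"
    using L by (simp add: L_property_def)
  have cont_p: "continuous_map X euclideanreal (p y)" if "y \<in> topspace Y" for y
  proof -
    have "continuous_map X euclideanreal (\<lambda>x. f (x, y))"
      using sep that by (simp add: separately_continuous_def)
    then show ?thesis
      by (rule continuous_map_eq) (simp add: p_def)
  qed
  have "continuous_map Y P p"
    unfolding P_def continuous_map_componentwise
    using sep by (auto simp: p_def separately_continuous_def)
  then have p: "continuous_map Y Y' p"
    unfolding Y'_def using cont_p by (auto intro: continuous_map_into_subtopology)
  have h: "continuous_map (prod_topology X Y) (prod_topology X Y') (\<lambda>(x, y). (x, p y))"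
    using continuous_map_prod_top[of X Y X Y' "\<lambda>x. x" p] p by simp
  show ?thesis
    unfolding first_Lebesgue_class_def
  proof (intro allI impI)
    fix G :: "real set"
    assume "open G"
    then have "fsigma_in (prod_topology X Y') {z \<in> topspace (prod_topology X Y'). e z \<in> G}"
      using e by (simp add: first_Lebesgue_class_def)
    from fsigma_in_continuous_map_preimage[OF h this]
    have "fsigma_in (prod_topology X Y) {z \<in> topspace (prod_topology X Y).
        (\<lambda>(x, y). (x, p y)) z \<in> {z \<in> topspace (prod_topology X Y'). e z \<in> G}}" .
    moreover have "{z \<in> topspace (prod_topology X Y).
        (\<lambda>(x, y). (x, p y)) z \<in> {z \<in> topspace (prod_topology X Y'). e z \<in> G}}
      = {z \<in> topspace (prod_topology X Y). f z \<in> G}"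
      using p by (auto simp: e_def p_def continuous_map_def Pi_iff)
    ultimately show "fsigma_in (prod_topology X Y) {z \<in> topspace (prod_topology X Y). f z \<in> G}"
      by simp
  qed
qed

end

theory Submission
  imports Defs
begin

text \<open>
  Evaluation \<open>e (x, g) = g x\<close> is separately continuous on \<open>X \<times> C\<^sub>p(X)\<close>, so its zero set is an
  intersection of open sets \<open>W n\<close>. Near each point \<open>(x, 0)\<close> the set \<open>W n\<close> contains some
  \<open>U \<times> {g. g = 0 on A}\<close> with \<open>U\<close> an open neighbourhood of \<open>x\<close> and \<open>A\<close> finite. By the chain
  condition countably many of these \<open>U\<close> have a dense union; let \<open>D\<close> be the union, over all \<open>n\<close>, of
  the corresponding sets \<open>A\<close>. If the countable set \<open>D\<close> were not dense, then by the Baire property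
  some \<open>x\<close> outside its closure would lie in all these dense unions. A continuous \<open>g\<close> with
  \<open>g x = 1\<close> that vanishes on \<open>D\<close> then has \<open>(x, g)\<close> in every \<open>W n\<close>, although \<open>e (x, g) \<noteq> 0\<close>.
\<close>

text \<open>Zorn's lemma gives a maximal disjoint family \<open>\<U>\<close> of open sets, each
  inside some member of \<open>\<C>\<close>. The chain condition makes it countable and maximality
  makes its union dense; enlarging each set to a member of \<open>\<C>\<close> keeps both
  properties.\<close>

lemma ccc_imp_countable_dense_subfamily:
  assumes ccc: "countable_chain_condition X"
    and op: "\<And>C. C \<in> \<C> \<Longrightarrow> openin X C" and cover: "topspace X \<subseteq> \<Union>\<C>"
  obtains \<D> where "countable \<D>" "\<D> \<subseteq> \<C>" "X closure_of \<Union>\<D> = topspace X"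
proof -
  define \<A> where
    "\<A> = {\<U>. (\<forall>U\<in>\<U>. openin X U \<and> (\<exists>C\<in>\<C>. U \<subseteq> C)) \<and> pairwise disjnt \<U>}"
  have "\<Union>\<K> \<in> \<A>" if "subset.chain \<A> \<K>" for \<K>
  proof -
    have "pairwise disjnt (\<Union>\<K>)"
      unfolding pairwise_def
    proof (intro ballI impI)
      fix U V assume "U \<in> \<Union>\<K>" "V \<in> \<Union>\<K>" "U \<noteq> V"
      then obtain K L where "K \<in> \<K>" "L \<in> \<K>" "U \<in> K" "V \<in> L"
        by blast
      moreover have "K \<subseteq> L \<or> L \<subseteq> K"
        using that \<open>K \<in> \<K>\<close> \<open>L \<in> \<K>\<close> by (auto simp: subset_chain_def)
      ultimately obtain M where "M \<in> \<K>" "U \<in> M" "V \<in> M"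
        by blast
      moreover have "pairwise disjnt M"
        using that \<open>M \<in> \<K>\<close> by (auto simp: subset_chain_def \<A>_def)
      ultimately show "disjnt U V"
        using \<open>U \<noteq> V\<close> by (simp add: pairwise_def)
    qed
    moreover have "\<forall>U\<in>\<Union>\<K>. openin X U \<and> (\<exists>C\<in>\<C>. U \<subseteq> C)"
      using that unfolding subset_chain_def \<A>_def by blast
    ultimately show ?thesis
      by (simp add: \<A>_def)
  qed
  then obtain \<U> where \<U>: "\<U> \<in> \<A>" and max: "\<And>\<V>. \<V> \<in> \<A> \<Longrightarrow> \<U> \<subseteq> \<V> \<Longrightarrow> \<V> = \<U>"
    using subset_Zorn'[of \<A>] by blast
  have "countable \<U>"
    using ccc \<U> by (simp add: countable_chain_condition_def \<A>_def)
  obtain c where c: "\<And>U. U \<in> \<U> \<Longrightarrow> c U \<in> \<C> \<and> U \<subseteq> c U"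
    using \<U> unfolding \<A>_def mem_Collect_eq by metis
  have "x \<in> X closure_of \<Union>\<U>" if x: "x \<in> topspace X" for x
  proof (rule ccontr)
    assume "x \<notin> X closure_of \<Union>\<U>"
    then obtain T where T: "openin X T" "x \<in> T" "T \<inter> \<Union>\<U> = {}"
      using x by (auto simp: in_closure_of)
    obtain C where C: "C \<in> \<C>" "x \<in> C"
      using x cover by blast
    \<comment> \<open>\<open>T \<inter> C\<close> is disjoint from every member of
      \<open>\<U>\<close>, so by maximality it already belongs to \<open>\<U>\<close>; but it
      contains \<open>x\<close>, and \<open>T\<close> misses the union.\<close>
    have "openin X (T \<inter> C)"
      using T C op by blast
    then have "insert (T \<inter> C) \<U> \<in> \<A>"
      using \<U> T C by (auto simp: \<A>_def pairwise_insert disjnt_iff)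
    then have "T \<inter> C \<in> \<U>"
      using max by blast
    then show False
      using T C by blast
  qed
  then have "topspace X \<subseteq> X closure_of \<Union>\<U>"
    by blast
  also have "\<dots> \<subseteq> X closure_of \<Union>(c ` \<U>)"
    using c by (intro closure_of_mono) blast
  finally have "X closure_of \<Union>(c ` \<U>) = topspace X"
    by (simp add: antisym closure_of_subset_topspace)
  moreover have "c ` \<U> \<subseteq> \<C>"
    using c by blast
  ultimately show thesis
    using that[of "c ` \<U>"] \<open>countable \<U>\<close> by simp
qed

text \<open>A basic box around \<open>g\<close> inside the open set constrains only finitely many
  coordinates, and these form \<open>A\<close>.\<close>

lemma openin_subtopology_product_finite_support:
  assumes "openin (subtopology (product_topology T I) S) V" and "g \<in> V"
  obtains A where "finite A" "A \<subseteq> I"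
    "\<And>h. h \<in> topspace (product_topology T I) \<inter> S \<Longrightarrow> (\<And>a. a \<in> A \<Longrightarrow> h a = g a) \<Longrightarrow> h \<in> V"
proof -
  obtain V' where V': "openin (product_topology T I) V'" "V = V' \<inter> S"
    using assms(1) by (auto simp: openin_subtopology)
  then obtain U where U: "finite {i \<in> I. U i \<noteq> topspace (T i)}" "g \<in> Pi\<^sub>E I U" "Pi\<^sub>E I U \<subseteq> V'"
    using assms(2) unfolding openin_product_topology_alt by (metis IntD1)
  show thesis
  proof (rule that[OF U(1)])
    fix h
    assume h: "h \<in> topspace (product_topology T I) \<inter> S"
      and eq: "\<And>a. a \<in> {i \<in> I. U i \<noteq> topspace (T i)} \<Longrightarrow> h a = g a"
    have "h i \<in> U i" if "i \<in> I" for i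
      using that h eq[of i] U(2) by (cases "U i = topspace (T i)") (auto simp: PiE_iff)
    then have "h \<in> Pi\<^sub>E I U"
      using h by (auto simp: PiE_iff)
    then show "h \<in> V"
      using U(3) V'(2) h by blast
  qed auto
qed

theorem corollary2p2:
  fixes X :: "'a topology"
  assumes "completely_regular_space X"
    and "Baire_space X"
    and "L_property X"
    and "countable_chain_condition X"
  shows "separable_space X"
proof -
  define P where "P = product_topology (\<lambda>_::'a. euclideanreal) (topspace X)"
  define S where "S = {g. continuous_map X euclideanreal g}"
  define Y where "Y = subtopology P S"
  define e :: "'a \<times> ('a \<Rightarrow> real) \<Rightarrow> real" where "e = (\<lambda>(x, g). g x)"
  have Y_iff: "g \<in> topspace Y \<longleftrightarrow> g \<in> extensional (topspace X) \<and> continuous_map X euclideanreal g" for g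
    by (auto simp: Y_def P_def S_def PiE_iff)
  \<comment> \<open>Points of a product space are extensional, so a continuous function becomes a
    point of \<open>Y\<close> only after restriction.\<close>
  have restrict_Y: "restrict g (topspace X) \<in> topspace Y" if "continuous_map X euclideanreal g" for g
    unfolding Y_iff using that by (auto intro: continuous_map_eq)
  have "continuous_map P euclideanreal (\<lambda>g. g x)" if "x \<in> topspace X" for x
    using that unfolding P_def by (rule continuous_map_product_projection)
  then have "separately_continuous X Y e"
    unfolding separately_continuous_def Y_def S_def e_def
    by (auto intro: continuous_map_from_subtopology)
  then have "first_Lebesgue_class (prod_topology X Y) e"
    using assms(3) by (simp add: L_property_def)
  then have "fsigma_in (prod_topology X Y) {z \<in> topspace (prod_topology X Y). e z \<in> - {0}}"
    unfolding first_Lebesgue_class_def by blast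
  moreover have "topspace (prod_topology X Y) - {z \<in> topspace (prod_topology X Y). e z \<in> - {0}}
      = {z \<in> topspace (prod_topology X Y). e z = 0}"
    by auto
  ultimately have "gdelta_in (prod_topology X Y) {z \<in> topspace (prod_topology X Y). e z = 0}"
    by (simp add: fsigma_in_gdelta_in)
  then obtain W :: "nat \<Rightarrow> ('a \<times> ('a \<Rightarrow> real)) set"
    where W: "\<And>n. openin (prod_topology X Y) (W n)"
      and W_Inter: "\<Inter>(range W) = {z \<in> topspace (prod_topology X Y). e z = 0}"
    unfolding gdelta_in_descending by blast
  \<comment> \<open>For \<open>x\<close> in \<open>U\<close>, vanishing of \<open>g\<close> on
    \<open>A\<close> alone puts \<open>(x, g)\<close> into \<open>W n\<close>, whatever the value
    \<open>g x\<close>.\<close>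
  define good where "good n U A \<longleftrightarrow> finite A \<and> A \<subseteq> topspace X \<and>
    U \<times> {g \<in> topspace Y. \<forall>a\<in>A. g a = 0} \<subseteq> W n" for n U A
  define \<C> where "\<C> n = {U. openin X U \<and> (\<exists>A. good n U A)}" for n
  define zero where "zero = restrict (\<lambda>_. 0::real) (topspace X)"
  have zero: "zero \<in> topspace Y"
    unfolding zero_def by (rule restrict_Y) simp
  have cover: "topspace X \<subseteq> \<Union>(\<C> n)" for n
  proof
    fix x assume x: "x \<in> topspace X"
    then have "(x, zero) \<in> \<Inter>(range W)"
      unfolding W_Inter using zero by (simp add: e_def zero_def)
    then have "(x, zero) \<in> W n"
      by blast
    then obtain U V where UV: "openin X U" "openin Y V" "x \<in> U" "zero \<in> V" "U \<times> V \<subseteq> W n"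
      using W[of n] unfolding openin_prod_topology_alt by metis
    obtain A where A: "finite A" "A \<subseteq> topspace X"
      "\<And>h. h \<in> topspace P \<inter> S \<Longrightarrow> (\<And>a. a \<in> A \<Longrightarrow> h a = zero a) \<Longrightarrow> h \<in> V"
      using openin_subtopology_product_finite_support[OF UV(2)[unfolded Y_def P_def] UV(4)]
      unfolding P_def by metis
    have "g \<in> V" if "g \<in> topspace Y" "\<forall>a\<in>A. g a = 0" for g
      using that A(2) by (intro A(3)) (auto simp: Y_def zero_def)
    then have "good n U A"
      unfolding good_def using A(1,2) UV(5) by blast
    then show "x \<in> \<Union>(\<C> n)"
      using UV(1,3) by (auto simp: \<C>_def)
  qed
  have "\<exists>\<D>. countable \<D> \<and> \<D> \<subseteq> \<C> n \<and> X closure_of \<Union>\<D> = topspace X" for n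
    by (rule ccc_imp_countable_dense_subfamily[OF assms(4) _ cover[of n]]) (auto simp: \<C>_def)
  then obtain \<D> where \<D>: "\<And>n. countable (\<D> n)" "\<And>n. \<D> n \<subseteq> \<C> n"
    "\<And>n. X closure_of \<Union>(\<D> n) = topspace X"
    by metis
  then have "\<forall>n. \<forall>U\<in>\<D> n. \<exists>A. good n U A"
    by (auto simp: \<C>_def)
  then obtain A where A: "\<And>n U. U \<in> \<D> n \<Longrightarrow> good n U (A n U)"
    by metis
  define D where "D = (\<Union>n. \<Union>U\<in>\<D> n. A n U)"
  have "countable D"
    unfolding D_def using \<D>(1) A by (intro countable_UN) (simp_all add: good_def countable_finite)
  moreover have "D \<subseteq> topspace X"
    unfolding D_def using A by (auto simp: good_def)
  moreover have "X closure_of D = topspace X"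
  proof (rule ccontr)
    assume "X closure_of D \<noteq> topspace X"
    then obtain x0 where x0: "x0 \<in> topspace X" "x0 \<notin> X closure_of D"
      using closure_of_subset_topspace[of X D] by blast
    \<comment> \<open>\<open>G\<close> is dense by the Baire property, so it meets the open
      complement of the closure of \<open>D\<close>, which contains \<open>x0\<close>.\<close>
    define G where "G = topspace X \<inter> (\<Inter>n. \<Union>(\<D> n))"
    have "openin X (\<Union>(\<D> n))" for n
      using \<D>(2)[of n] by (auto simp: \<C>_def)
    then have "x0 \<in> X closure_of G"
      using assms(2)[unfolded Baire_space_def, rule_format, of "range (\<lambda>n. \<Union>(\<D> n))"]
        \<D>(3) x0(1)
      by (simp add: G_def image_iff)
    moreover have "openin X (topspace X - X closure_of D)"
      by (simp add: openin_diff)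
    ultimately obtain x where x: "x \<in> G" "x \<in> topspace X" "x \<notin> X closure_of D"
      using x0 unfolding in_closure_of[of x0 X G] by blast
    obtain g where g: "continuous_map X euclideanreal g" "g x = 1" "g ` (X closure_of D) \<subseteq> {0}"
      using assms(1) x(2,3) closedin_closure_of[of X D]
      unfolding completely_regular_space_gen_alt[of 1 0, OF one_neq_zero] by blast
    define h where "h = restrict g (topspace X)"
    have h: "h \<in> topspace Y"
      unfolding h_def using g(1) by (rule restrict_Y)
    have h0: "h a = 0" if "a \<in> D" for a
      using that g(3) closure_of_subset[OF \<open>D \<subseteq> topspace X\<close>] \<open>D \<subseteq> topspace X\<close>
      by (auto simp: h_def)
    have "(x, h) \<in> W n" for n
    proof -
      \<comment> \<open>\<open>U\<close> may vary with \<open>n\<close>, but \<open>D\<close>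
        contains every \<open>A n U\<close>, so the single function \<open>h\<close> serves all
        \<open>n\<close>.\<close>
      obtain U where U: "U \<in> \<D> n" "x \<in> U"
        using x(1) by (auto simp: G_def)
      have "\<forall>a\<in>A n U. h a = 0"
        using h0 U(1) by (auto simp: D_def)
      then show ?thesis
        using A[OF U(1)] U(2) h by (auto simp: good_def)
    qed
    then have "(x, h) \<in> \<Inter>(range W)"
      by blast
    then have "e (x, h) = 0"
      unfolding W_Inter by simp
    then show False
      using g(2) x(2) by (simp add: e_def h_def)
  qed
  ultimately show ?thesis
    unfolding separable_space_def by blast
qed

end
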